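(* Let $R$ be a commutative ring with identity and suppose that $(G,\alpha)$ is an edge-labeled graph on $n$ vertices. Fix a spanning tree $T$ for $G$. For each edge $e\in E(G)-E(T)$ let $C_e$ denote the unique cycle contained in $T\cup\{e\}$. Then the extended GKM matrix for $G$ is equivalent to an extended GKM matrix for $T$, followed for each edge $e\in E(G)-E(T)$ by a row that is zero except in the last column, which is $\sum_{e'\in C_e}q_{e'}$ where $q_{e'}$ are arbitrary elements of $\alpha(e')$.
   Context: Graphs are finite with no multiple edges. An edge-labeling function on a graph $G=(V,E)$ is a map $\alpha$ from $E$ to the nonzero ideals of $R$; the tree $T$ carries the restriction of $\alpha$. The edges are given directions, whose choice does not matter. The GKM matrix of a directed edge-labeled graph $(G,\alpha)$ is the $|E|\times|V|$ matrix whose row for the directed edge $e=uv$ has $1$ in the column of $u$, $-1$ in the column of $v$, and $0$ elsewhere. An extended GKM matrix of $(G,\alpha)$ is an $|E|\times(|V|+1)$ matrix whose first $|V|$ columns are the GKM matrix and whose last entry in the row of edge $e$ is any element of $\alpha(e)$. These matrices are viewed as augmented matrices of systems of linear equations over $R$, and "equivalent" is used in the sense of passing to an equivalent system by reversible (invertible over $R$) operations. *)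

theory Defs
  imports "Jordan_Normal_Form.Matrix" "HOL-Library.FuncSet"
begin

(* An undirected simple graph is a vertex set V with a set E of two-element subsets of V.
   The notions of tree, forest and cycle in the entry Graph_Theory concern directed cycles
   and are not the undirected ones needed here. *)

definition simple_graph :: "'v set \<Rightarrow> 'v set set \<Rightarrow> bool" where
  "simple_graph V E \<longleftrightarrow> finite V \<and> (\<forall>e\<in>E. e \<subseteq> V \<and> card e = 2)"

definition connected_graph :: "'v set \<Rightarrow> 'v set set \<Rightarrow> bool" where
  "connected_graph V E \<longleftrightarrow> (\<forall>u\<in>V. \<forall>v\<in>V. (u, v) \<in> {(x, y). {x, y} \<in> E}\<^sup>*)"

(* A cycle is identified with its set of edges; xs lists its vertices in cyclic order. *)
definition cycle_in :: "'v set set \<Rightarrow> 'v set set \<Rightarrow> bool" where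
  "cycle_in E C \<longleftrightarrow> C \<subseteq> E \<and>
     (\<exists>xs. distinct xs \<and> length xs \<ge> 3 \<and>
        C = {{xs ! i, xs ! (Suc i mod length xs)} | i. i < length xs})"

definition spanning_tree :: "'v set \<Rightarrow> 'v set set \<Rightarrow> 'v set set \<Rightarrow> bool" where
  "spanning_tree V E T \<longleftrightarrow> T \<subseteq> E \<and> connected_graph V T \<and> (\<nexists>C. cycle_in T C)"

definition fundamental_cycle :: "'v set set \<Rightarrow> 'v set \<Rightarrow> 'v set set" where
  "fundamental_cycle T e = (THE C. cycle_in (insert e T) C)"

(* Ideals are the submodules of the ring regarded as a module over itself. *)
definition nonzero_ideal :: "'r::comm_ring_1 set \<Rightarrow> bool" where
  "nonzero_ideal I \<longleftrightarrow> module.subspace (*) I \<and> I \<noteq> {0}"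

definition edge_labeling :: "'v set set \<Rightarrow> ('v set \<Rightarrow> 'r::comm_ring_1 set) \<Rightarrow> bool" where
  "edge_labeling E \<alpha> \<longleftrightarrow> (\<forall>e\<in>E. nonzero_ideal (\<alpha> e))"

(* The edge e is directed from src e to tgt e. *)
definition orientation :: "'v set set \<Rightarrow> ('v set \<Rightarrow> 'v) \<Rightarrow> ('v set \<Rightarrow> 'v) \<Rightarrow> bool" where
  "orientation E src tgt \<longleftrightarrow> (\<forall>e\<in>E. e = {src e, tgt e})"

definition enumerates :: "'a list \<Rightarrow> 'a set \<Rightarrow> bool" where
  "enumerates xs A \<longleftrightarrow> distinct xs \<and> set xs = A"

(* Rows and columns are indexed by enumerations es of the edges and vs of the vertices. *)
definition gkm_matrix ::
    "('v set \<Rightarrow> 'v) \<Rightarrow> ('v set \<Rightarrow> 'v) \<Rightarrow> 'v list \<Rightarrow> 'v set list \<Rightarrow> 'r::comm_ring_1 mat" where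
  "gkm_matrix src tgt vs es = mat (length es) (length vs)
     (\<lambda>(i, j). if vs ! j = src (es ! i) then 1 else if vs ! j = tgt (es ! i) then - 1 else 0)"

(* The extended GKM matrices of an edge-labeled graph are the ones obtained here from
   the choices q of an element q e of the label of each edge e. *)
definition extended_gkm_matrix ::
    "('v set \<Rightarrow> 'v) \<Rightarrow> ('v set \<Rightarrow> 'v) \<Rightarrow> 'v list \<Rightarrow> 'v set list \<Rightarrow> ('v set \<Rightarrow> 'r) \<Rightarrow>
     'r::comm_ring_1 mat" where
  "extended_gkm_matrix src tgt vs es q = mat (length es) (length vs + 1)
     (\<lambda>(i, j). if j < length vs then gkm_matrix src tgt vs es $$ (i, j) else q (es ! i))"

(* Rows that vanish except in the last of n + 1 columns, one for each edge e in the list cs. *)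
definition last_column_rows :: "nat \<Rightarrow> 'e list \<Rightarrow> ('e \<Rightarrow> 'r) \<Rightarrow> 'r::comm_ring_1 mat" where
  "last_column_rows n cs s = mat (length cs) (n + 1) (\<lambda>(i, j). if j = n then s (cs ! i) else 0)"

definition row_equivalent :: "'r::comm_ring_1 mat \<Rightarrow> 'r mat \<Rightarrow> bool" where
  "row_equivalent A B \<longleftrightarrow>
     (\<exists>P \<in> carrier_mat (dim_row A) (dim_row A). invertible_mat P \<and> B = P * A)"

end

theory Submission
  imports Defs
begin

(* A signed cycle is orthogonal to every coboundary \<phi> (src e) - \<phi> (tgt e).  Taking indicators
   of vertices for \<phi>, this says that the signed sum of the GKM rows along C_e vanishes, so that
   the row of e can be replaced by the last column entry of that sum.  Taking for \<phi> the
   indicator of one side of a tree edge f, it determines whether f lies in C_e, so that C_e is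
   unique.  The row operation is I + N, where N only adds multiples of tree rows to non-tree
   rows; hence N^2 = 0 and I - N is the inverse. *)

section \<open>Paths and cycles in undirected graphs\<close>

text \<open>Prepending a vertex that is already on the path would repeat it; in that case the path
  is cut down to its suffix starting at that vertex.\<close>

lemma rtrancl_distinct_path:
  assumes "(u, v) \<in> {(x, y). {x, y} \<in> F}\<^sup>*"
  shows "\<exists>xs. xs \<noteq> [] \<and> hd xs = u \<and> last xs = v \<and> distinct xs \<and> successively (\<lambda>x y. {x, y} \<in> F) xs"
  using assms
proof (induction rule: converse_rtrancl_induct)
  case base
  show ?case by (intro exI[of _ "[v]"]) simp
next
  case (step u w)
  then obtain xs where xs: "xs \<noteq> []" "hd xs = w" "last xs = v" "distinct xs"
    "successively (\<lambda>x y. {x, y} \<in> F) xs" by blast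
  show ?case
  proof (cases "u \<in> set xs")
    case True
    then obtain ys zs where "xs = ys @ u # zs" by (meson split_list)
    with xs show ?thesis
      by (intro exI[of _ "u # zs"]) (auto simp: successively_append_iff)
  next
    case False
    with xs step(1) show ?thesis
      by (intro exI[of _ "u # xs"]) (auto simp: successively_Cons)
  qed
qed

text \<open>A path with distinct vertices from \<open>u\<close> to \<open>v\<close> is closed up by
  the new edge \<open>{u, v}\<close>. It has at least three vertices: one vertex would give
  \<open>u = v\<close>, two would put \<open>{u, v}\<close> into \<open>F\<close>.\<close>

lemma connected_endpoints_imp_cycle:
  assumes "(u, v) \<in> {(x, y). {x, y} \<in> F}\<^sup>*" "u \<noteq> v" "{u, v} \<notin> F"
  shows "\<exists>C. cycle_in (insert {u, v} F) C"
proof -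
  obtain xs where xs: "xs \<noteq> []" "hd xs = u" "last xs = v" "distinct xs"
    "successively (\<lambda>x y. {x, y} \<in> F) xs"
    using rtrancl_distinct_path[OF assms(1)] by blast
  have len: "length xs \<ge> 3"
  proof (rule ccontr)
    assume "\<not> length xs \<ge> 3"
    then consider "length xs = 0" | "length xs = 1" | "length xs = 2" by linarith
    then show False
      by cases (use xs assms(2,3) in \<open>auto simp: length_Suc_conv numeral_2_eq_2\<close>)
  qed
  have "{xs ! i, xs ! (Suc i mod length xs)} \<in> insert {u, v} F" if "i < length xs" for i
  \<comment> \<open>The index that wraps around gives the closing edge; all others give edges of the
    path.\<close>
  proof (cases "Suc i = length xs")
    case True
    then have "length xs - 1 = i" by simp
    then have "xs ! i = v" "xs ! 0 = u" using xs by (simp_all add: last_conv_nth hd_conv_nth)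
    with True show ?thesis by (simp add: insert_commute)
  next
    case False
    with that have "Suc i < length xs" by simp
    with xs(5) show ?thesis by (auto simp: successively_conv_nth)
  qed
  then have "{{xs ! i, xs ! (Suc i mod length xs)} | i. i < length xs} \<subseteq> insert {u, v} F"
    by blast
  then show ?thesis
    unfolding cycle_in_def by (intro exI conjI) (assumption, rule xs(4), rule len, rule refl)
qed

section \<open>Signed cycles and coboundaries\<close>

text \<open>The sign of an edge records whether its direction agrees with the traversal of the
  cycle. Each term then becomes the drop of \<open>\<phi>\<close> from one vertex of the cycle to
  the next, and these drops cancel around the cycle. The signs are fixed before
  \<open>\<phi>\<close>.\<close>

lemma cycle_signs:
  fixes src tgt :: "'v set \<Rightarrow> 'v"
  assumes "cycle_in F C" "orientation C src tgt"
  shows "\<exists>s :: 'v set \<Rightarrow> 'r::comm_ring_1. (\<forall>e. s e \<in> {1, - 1}) \<and>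
    (\<forall>\<phi>. (\<Sum>e\<in>C. s e * (\<phi> (src e) - \<phi> (tgt e))) = 0)"
proof -
  obtain xs where xs: "distinct xs" "length xs \<ge> 3"
    and C: "C = {{xs ! i, xs ! (Suc i mod length xs)} | i. i < length xs}"
    using assms(1) unfolding cycle_in_def by blast
  define n where "n = length xs"
  define nx where "nx i = Suc i mod n" for i
  define ed where "ed i = {xs ! i, xs ! nx i}" for i
  have n: "n \<ge> 3" and nx_lt: "nx i < n" for i
  proof -
    show n: "n \<ge> 3" using xs(2) by (simp add: n_def)
    show "nx i < n" unfolding nx_def by (rule mod_less_divisor) (use n in simp)
  qed
  have xs_eq: "xs ! i = xs ! j \<longleftrightarrow> i = j" if "i < n" "j < n" for i j
    using that xs(1) by (simp add: n_def nth_eq_iff_index_eq)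
  have nx_cases: "nx i = (if Suc i = n then 0 else Suc i)" if "i < n" for i
    using that by (auto simp: nx_def)
  have C_eq: "C = ed ` {..<n}" by (auto simp: C ed_def nx_def n_def)
  have inj_nx: "inj_on nx {..<n}"
    by (auto simp: inj_on_def nx_cases split: if_splits)
  have bij_nx: "bij_betw nx {..<n} {..<n}"
    unfolding bij_betw_def using inj_nx nx_lt by (intro conjI endo_inj_surj) auto
  \<comment> \<open>Two positions with the same edge would be cyclic successors of each other, which
    is impossible for \<open>n \<ge> 3\<close>.\<close>
  have inj_ed: "inj_on ed {..<n}"
  proof (rule inj_onI)
    fix i j assume ij: "i \<in> {..<n}" "j \<in> {..<n}" "ed i = ed j"
    then have "i = j \<or> (i = nx j \<and> j = nx i)"
      using nx_lt by (auto simp: ed_def doubleton_eq_iff xs_eq)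
    with ij n show "i = j" by (auto simp: nx_cases split: if_splits)
  qed
  define s :: "'v set \<Rightarrow> 'r" where
    "s e = (if \<exists>i<n. e = ed i \<and> src e = xs ! i then 1 else - 1)" for e
  have "(\<Sum>e\<in>C. s e * (\<phi> (src e) - \<phi> (tgt e))) = 0" for \<phi>
  proof -
    have step: "s (ed i) * (\<phi> (src (ed i)) - \<phi> (tgt (ed i))) = \<phi> (xs ! i) - \<phi> (xs ! nx i)"
      if i: "i < n" for i
    proof -
      have ed: "ed i = {src (ed i), tgt (ed i)}"
        using assms(2) i by (auto simp: orientation_def C_eq)
      have s: "s (ed i) = (if src (ed i) = xs ! i then 1 else - 1)"
        using i inj_on_eq_iff[OF inj_ed] by (auto simp: s_def)
      from ed have "src (ed i) = xs ! i \<and> tgt (ed i) = xs ! nx i \<or>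
          src (ed i) = xs ! nx i \<and> tgt (ed i) = xs ! i"
        unfolding ed_def[of i] by (metis doubleton_eq_iff)
      then show ?thesis using s by auto
    qed
    have "(\<Sum>e\<in>C. s e * (\<phi> (src e) - \<phi> (tgt e))) = (\<Sum>i<n. \<phi> (xs ! i) - \<phi> (xs ! nx i))"
      unfolding C_eq sum.reindex[OF inj_ed] by (intro sum.cong) (auto simp: step)
    also have "\<dots> = (\<Sum>i<n. \<phi> (xs ! i)) - (\<Sum>i<n. \<phi> (xs ! nx i))"
      by (rule sum_subtractf)
    also have "\<dots> = 0"
      using sum.reindex_bij_betw[OF bij_nx, of "\<lambda>i. \<phi> (xs ! i)"] by simp
    finally show ?thesis .
  qed
  moreover have "\<forall>e. s e \<in> {1, - 1}" by (auto simp: s_def)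
  ultimately show ?thesis by blast
qed

text \<open>All signs are multiplied by the sign of \<open>e\<^sub>0\<close>, whose square is 1.
  This lets the row of a non-tree edge enter its own cycle relation with coefficient 1.\<close>

lemma cycle_signs_normalised:
  fixes src tgt :: "'v set \<Rightarrow> 'v"
  assumes "cycle_in F C" "orientation C src tgt"
  shows "\<exists>s :: 'v set \<Rightarrow> 'r::comm_ring_1. (\<forall>e. s e \<in> {1, - 1}) \<and> s e\<^sub>0 = 1 \<and>
    (\<forall>\<phi>. (\<Sum>e\<in>C. s e * (\<phi> (src e) - \<phi> (tgt e))) = 0)"
proof -
  obtain s :: "'v set \<Rightarrow> 'r" where s: "\<And>e. s e \<in> {1, - 1}"
    "\<And>\<phi>. (\<Sum>e\<in>C. s e * (\<phi> (src e) - \<phi> (tgt e))) = 0"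
    using cycle_signs[OF assms] by blast
  have "s e\<^sub>0 * s e \<in> {1, - 1}" for e using s(1)[of e] s(1)[of e\<^sub>0] by auto
  moreover have "s e\<^sub>0 * s e\<^sub>0 = 1" using s(1)[of e\<^sub>0] by auto
  moreover have "(\<Sum>e\<in>C. s e\<^sub>0 * s e * (\<phi> (src e) - \<phi> (tgt e))) = 0" for \<phi>
    using s(2)[of \<phi>] by (simp add: mult.assoc flip: sum_distrib_left)
  ultimately show ?thesis by (intro exI[of _ "\<lambda>e. s e\<^sub>0 * s e"]) blast
qed

section \<open>Cuts of a spanning tree and uniqueness of the fundamental cycle\<close>

text \<open>\<open>U\<close> consists of the vertices reachable from \<open>src f\<close> in
  \<open>T - {f}\<close>. If it contained \<open>tgt f\<close>, then \<open>f\<close> would close a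
  cycle inside \<open>T\<close>.\<close>

lemma spanning_tree_cut:
  assumes "spanning_tree V E T" "orientation E src tgt" "f \<in> T" "src f \<noteq> tgt f"
  shows "\<exists>U. src f \<in> U \<and> tgt f \<notin> U \<and> (\<forall>g\<in>T - {f}. src g \<in> U \<longleftrightarrow> tgt g \<in> U)"
proof -
  define r where "r = {(x, y). {x, y} \<in> T - {f}}"
  have T: "T \<subseteq> E" "\<nexists>C. cycle_in T C" using assms(1) by (auto simp: spanning_tree_def)
  have ends: "g = {src g, tgt g}" if "g \<in> T" for g
    using that T(1) assms(2) by (auto simp: orientation_def)
  have "(src f, tgt f) \<notin> r\<^sup>*"
  proof
    assume "(src f, tgt f) \<in> r\<^sup>*"
    then have "\<exists>C. cycle_in (insert {src f, tgt f} (T - {f})) C"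
      using connected_endpoints_imp_cycle[of "src f" "tgt f" "T - {f}"] assms(4) ends[OF assms(3)]
      unfolding r_def by auto
    with ends[OF assms(3)] assms(3) T(2) show False by (simp add: insert_absorb)
  qed
  moreover have "(src f, src g) \<in> r\<^sup>* \<longleftrightarrow> (src f, tgt g) \<in> r\<^sup>*" if "g \<in> T - {f}" for g
  proof -
    have "(src g, tgt g) \<in> r" "(tgt g, src g) \<in> r"
      using that ends[of g] by (auto simp: r_def insert_commute)
    then show ?thesis by (meson rtrancl.rtrancl_into_rtrancl)
  qed
  ultimately show ?thesis by (intro exI[of _ "{x. (src f, x) \<in> r\<^sup>*}"]) auto
qed

lemma cycle_in_mono:
  assumes "cycle_in F C" "C \<subseteq> F'"
  shows "cycle_in F' C"
  using assms(1) unfolding cycle_in_def by (simp add: assms(2))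

lemma cycle_in_finite: "finite C" if C: "cycle_in F C"
proof -
  obtain xs where "C = (\<lambda>i. {xs ! i, xs ! (Suc i mod length xs)}) ` {..<length xs}"
    using C unfolding cycle_in_def by blast
  then show ?thesis by simp
qed

lemma cycle_in_insert_mem:
  assumes "cycle_in (insert e F) C" "\<nexists>C. cycle_in F C"
  shows "e \<in> C"
proof (rule ccontr)
  assume "e \<notin> C"
  moreover have "C \<subseteq> insert e F" using assms(1) unfolding cycle_in_def by (rule conjunct1)
  ultimately have "C \<subseteq> F" by blast
  then have "cycle_in F C" by (rule cycle_in_mono[OF assms(1)])
  with assms(2) show False by blast
qed

text \<open>The right-hand side does not mention \<open>C\<close>, so any two cycles in
  \<open>insert e T\<close> contain the same tree edges. In the cycle relation for the indicator of
  \<open>U\<close> only \<open>e\<close> and \<open>f\<close> can contribute, so either both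
  contribute or neither does.\<close>

lemma cycle_in_spanning_tree_insert_mem_iff:
  assumes "spanning_tree V E T" "orientation E src tgt" "e \<in> E - T"
    and C: "cycle_in (insert e T) C"
    and f: "f \<in> T" "src f \<in> U" "tgt f \<notin> U" "\<forall>g\<in>T - {f}. src g \<in> U \<longleftrightarrow> tgt g \<in> U"
  shows "f \<in> C \<longleftrightarrow> \<not> (src e \<in> U \<longleftrightarrow> tgt e \<in> U)"
proof -
  have T: "T \<subseteq> E" "\<nexists>C. cycle_in T C" using assms(1) by (auto simp: spanning_tree_def)
  have CT: "C \<subseteq> insert e T" using C by (simp add: cycle_in_def)
  have "f \<noteq> e" using f(1) assms(3) by blast
  have eC: "e \<in> C" using C T(2) by (rule cycle_in_insert_mem)
  have "orientation C src tgt"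
    using CT T(1) assms(2,3) by (auto simp: orientation_def)
  \<comment> \<open>The claim concerns the graph alone, so the signs are taken in the
    integers.\<close>
  then obtain s :: "'a set \<Rightarrow> int" where s: "\<And>e. s e \<in> {1, - 1}"
    "\<And>\<phi>. (\<Sum>e\<in>C. s e * (\<phi> (src e) - \<phi> (tgt e))) = 0"
    using cycle_signs[OF C] by blast
  define d :: "'a set \<Rightarrow> int" where "d g = of_bool (src g \<in> U) - of_bool (tgt g \<in> U)" for g
  have "0 = (\<Sum>g\<in>C. s g * d g)"
    using s(2)[of "\<lambda>x. of_bool (x \<in> U)"] by (simp add: d_def)
  \<comment> \<open>Any other edge of \<open>C\<close> is a tree edge that does not cross the cut,
    so its \<open>d\<close> is 0.\<close>
  also have "\<dots> = (\<Sum>g\<in>C \<inter> {e, f}. s g * d g)"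
    by (rule sum.mono_neutral_right) (use cycle_in_finite[OF C] CT f(4) in \<open>auto simp: d_def\<close>)
  also have "\<dots> = s e * d e + (if f \<in> C then s f else 0)"
    using eC f(1-3) assms(3) \<open>f \<noteq> e\<close> by (simp add: Int_insert_right d_def)
  finally show ?thesis using s(1)[of e] s(1)[of f] by (auto simp: d_def of_bool_def split: if_splits)
qed

text \<open>This justifies the definite description. The tree path between the ends of
  \<open>e\<close> gives existence. For uniqueness, every cycle contains \<open>e\<close> because
  \<open>T\<close> is acyclic, and its tree edges are determined by the cuts.\<close>

lemma fundamental_cycle:
  assumes "simple_graph V E" "spanning_tree V E T" "orientation E src tgt" "e \<in> E - T"
  shows "cycle_in (insert e T) (fundamental_cycle T e)"
proof -
  have T: "T \<subseteq> E" "\<nexists>C. cycle_in T C" "connected_graph V T"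
    using assms(2) by (auto simp: spanning_tree_def)
  have ends: "g = {src g, tgt g}" "src g \<noteq> tgt g" "g \<subseteq> V" if "g \<in> E" for g
  proof -
    show *: "g = {src g, tgt g}" using that assms(3) by (auto simp: orientation_def)
    have "card g = 2" "g \<subseteq> V" using that assms(1) by (auto simp: simple_graph_def)
    with * show "src g \<noteq> tgt g" "g \<subseteq> V" by (metis card_2_iff doubleton_eq_iff, simp)
  qed
  have "(src e, tgt e) \<in> {(x, y). {x, y} \<in> T}\<^sup>*"
    using T(3) ends[of e] assms(4) by (auto simp: connected_graph_def)
  then have "\<exists>C. cycle_in (insert e T) C"
    using connected_endpoints_imp_cycle[of "src e" "tgt e" T] ends[of e] assms(4) by auto
  moreover have "C = D" if C: "cycle_in (insert e T) C" and D: "cycle_in (insert e T) D" for C D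
  proof -
    have sub: "C \<subseteq> insert e T" "D \<subseteq> insert e T" using C D by (auto simp: cycle_in_def)
    have "e \<in> C" "e \<in> D" using cycle_in_insert_mem[OF C T(2)] cycle_in_insert_mem[OF D T(2)] .
    moreover have "f \<in> C \<longleftrightarrow> f \<in> D" if f: "f \<in> T" for f
    proof -
      obtain U where U: "src f \<in> U" "tgt f \<notin> U" "\<forall>g\<in>T - {f}. src g \<in> U \<longleftrightarrow> tgt g \<in> U"
        using spanning_tree_cut[OF assms(2,3) f] ends(2)[of f] f T(1) by blast
      show ?thesis
        using cycle_in_spanning_tree_insert_mem_iff[OF assms(2-4) C f U]
          cycle_in_spanning_tree_insert_mem_iff[OF assms(2-4) D f U] by simp
    qed
    ultimately show ?thesis using sub by blast
  qed
  ultimately have "\<exists>!C. cycle_in (insert e T) C" by (rule ex_ex1I)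
  then show ?thesis
    unfolding fundamental_cycle_def by (rule theI')
qed

section \<open>Matrices indexed by lists of labels\<close>

text \<open>Entries depend on labels instead of positions, so products become sums over sets of
  labels and a reordering of rows only changes the list.\<close>

definition list_mat :: "'a list \<Rightarrow> 'b list \<Rightarrow> ('a \<Rightarrow> 'b \<Rightarrow> 'r) \<Rightarrow> 'r mat" where
  "list_mat xs ys f = mat (length xs) (length ys) (\<lambda>(i, j). f (xs ! i) (ys ! j))"

lemma list_mat_carrier [simp]: "list_mat xs ys f \<in> carrier_mat (length xs) (length ys)"
  by (simp add: list_mat_def)

lemma dim_list_mat [simp]:
  "dim_row (list_mat xs ys f) = length xs" "dim_col (list_mat xs ys f) = length ys"
  by (simp_all add: list_mat_def)

lemma list_mat_cong:
  assumes "\<And>a b. a \<in> set xs \<Longrightarrow> b \<in> set ys \<Longrightarrow> f a b = g a b"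
  shows "list_mat xs ys f = list_mat xs ys g"
  unfolding list_mat_def by (rule eq_matI) (auto simp: assms)

lemma list_mat_mult:
  fixes f :: "'a \<Rightarrow> 'b \<Rightarrow> 'r::comm_ring_1"
  assumes "distinct ys"
  shows "list_mat xs ys f * list_mat ys zs g = list_mat xs zs (\<lambda>a c. \<Sum>b\<in>set ys. f a b * g b c)"
proof (rule eq_matI)
  fix i j assume "i < dim_row (list_mat xs zs (\<lambda>a c. \<Sum>b\<in>set ys. f a b * g b c))"
    and "j < dim_col (list_mat xs zs (\<lambda>a c. \<Sum>b\<in>set ys. f a b * g b c))"
  then have ij: "i < length xs" "j < length zs" by simp_all
  have "(\<Sum>b\<in>set ys. f (xs ! i) b * g b (zs ! j)) =
      (\<Sum>k<length ys. f (xs ! i) (ys ! k) * g (ys ! k) (zs ! j))"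
    by (rule sum.reindex_bij_betw[OF bij_betw_nth[OF assms], symmetric]) auto
  with ij show "(list_mat xs ys f * list_mat ys zs g) $$ (i, j) =
      list_mat xs zs (\<lambda>a c. \<Sum>b\<in>set ys. f a b * g b c) $$ (i, j)"
    by (simp add: list_mat_def scalar_prod_def atLeast0LessThan)
qed simp_all

lemma list_mat_one:
  "distinct xs \<Longrightarrow> list_mat xs xs (\<lambda>a b. of_bool (a = b)) = (1\<^sub>m (length xs) :: 'r::comm_ring_1 mat)"
  by (rule eq_matI) (auto simp: list_mat_def nth_eq_iff_index_eq)

lemma list_mat_append_rows:
  "list_mat xs zs f @\<^sub>r list_mat ys zs f = list_mat (xs @ ys) zs f"
  by (rule eq_matI) (auto simp: append_rows_def list_mat_def nth_append)

text \<open>Since rows and columns may be listed in different orders, this matrix is I + N up to a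
  permutation; the inverse is I - N with the two lists exchanged. The hypothesis kills each product
  separately, so no sum over \<open>b\<close> has to be evaluated.\<close>

lemma invertible_list_mat_square_zero:
  fixes N :: "'a \<Rightarrow> 'a \<Rightarrow> 'r::comm_ring_1"
  assumes "distinct xs" "distinct ys" "set xs = set ys"
    and N: "\<And>a b c. N a b * N b c = 0"
  shows "invertible_mat (list_mat xs ys (\<lambda>a b. of_bool (a = b) + N a b))"
proof -
  have len: "length xs = length ys" using assms(1-3) by (metis distinct_card)
  let ?P = "list_mat xs ys (\<lambda>a b. of_bool (a = b) + N a b)"
  let ?Q = "list_mat ys xs (\<lambda>a b. of_bool (a = b) - N a b)"
  have delta_left: "(\<Sum>b\<in>A. of_bool (a = b) * h b) = h a"
    if "finite A" "a \<in> A" for A a and h :: "'a \<Rightarrow> 'r"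
    using that sum.delta'[of A a h] by (simp add: of_bool_def if_distrib[of "\<lambda>x. x * _"] cong: if_cong)
  have delta_right: "(\<Sum>b\<in>A. h b * of_bool (b = c)) = h c"
    if "finite A" "c \<in> A" for A c and h :: "'a \<Rightarrow> 'r"
    using that sum.delta[of A c h] by (simp add: of_bool_def if_distrib[of "\<lambda>x. _ * x"] cong: if_cong)
  have 1: "(\<Sum>b\<in>A. (of_bool (a = b) + N a b) * (of_bool (b = c) - N b c)) = of_bool (a = c)"
    and 2: "(\<Sum>b\<in>A. (of_bool (a = b) - N a b) * (of_bool (b = c) + N b c)) = of_bool (a = c)"
    if "finite A" "a \<in> A" "c \<in> A" for A a c
    using that
    by (simp_all add: distrib_right left_diff_distrib distrib_left right_diff_distrib sum.distrib
        sum_subtractf N delta_left delta_right)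
  have "?P * ?Q = list_mat xs xs (\<lambda>a b. of_bool (a = b))"
    unfolding list_mat_mult[OF assms(2)] by (rule list_mat_cong) (use assms(3) in \<open>auto simp: 1\<close>)
  moreover have "?Q * ?P = list_mat ys ys (\<lambda>a b. of_bool (a = b))"
    unfolding list_mat_mult[OF assms(1)] by (rule list_mat_cong) (use assms(3) in \<open>auto simp: 2\<close>)
  ultimately show ?thesis
    using assms(1,2) len unfolding invertible_mat_def inverts_mat_def
    by (auto simp: list_mat_one)
qed

text \<open>Columns are labelled by their positions, because the last one belongs to no
  vertex.\<close>

lemma extended_gkm_matrix_eq_list_mat:
  "extended_gkm_matrix src tgt vs es q = list_mat es [0..<length vs + 1]
     (\<lambda>e j. if j < length vs
        then if vs ! j = src e then 1 else if vs ! j = tgt e then - 1 else 0 else q e)"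
  by (rule eq_matI) (simp_all add: extended_gkm_matrix_def gkm_matrix_def list_mat_def del: upt_Suc)

lemma last_column_rows_eq_list_mat:
  "last_column_rows n cs s = list_mat cs [0..<n + 1] (\<lambda>e j. if j = n then s e else 0)"
  by (rule eq_matI) (simp_all add: last_column_rows_def list_mat_def del: upt_Suc)

(* The elements of the labels summed over the cycle C_e are the entries q e' of the extended
   GKM matrix up to signs, which record how e' is directed relative to C_e and do not depend
   on q. An edge may occur with different signs in different cycles, so the signs cannot in
   general be removed by changing q. *)
theorem theorem6p3:
  fixes V :: "'v set" and E T :: "'v set set" and n :: nat
    and \<alpha> :: "'v set \<Rightarrow> 'r::comm_ring_1 set"
    and src tgt :: "'v set \<Rightarrow> 'v"
    and vs :: "'v list" and es ts cs :: "'v set list"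
  assumes "simple_graph V E" and "card V = n"
    and "edge_labeling E \<alpha>"
    and "orientation E src tgt"
    and "spanning_tree V E T"
    and "enumerates vs V" and "enumerates es E"
    and "enumerates ts T" and "enumerates cs (E - T)"
  shows "\<exists>\<sigma> :: 'v set \<Rightarrow> 'v set \<Rightarrow> 'r.
    (\<forall>e \<in> E - T. \<forall>e' \<in> fundamental_cycle T e. \<sigma> e e' \<in> {1, - 1}) \<and>
    (\<forall>q \<in> Pi E \<alpha>.
       row_equivalent (extended_gkm_matrix src tgt vs es q)
         (extended_gkm_matrix src tgt vs ts q @\<^sub>r
          last_column_rows n cs (\<lambda>e. \<Sum>e' \<in> fundamental_cycle T e. \<sigma> e e' * q e')))"
proof -
  let ?C = "fundamental_cycle T"
  have T: "T \<subseteq> E" "\<nexists>C. cycle_in T C" using assms(5) by (auto simp: spanning_tree_def)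
  have cyc: "cycle_in (insert e T) (?C e)" if "e \<in> E - T" for e
    using fundamental_cycle[OF assms(1,5,4) that] .
  have sub: "?C e \<subseteq> insert e T" if "e \<in> E - T" for e
    using cyc[OF that] by (simp add: cycle_in_def)
  have mem: "e \<in> ?C e" if "e \<in> E - T" for e
    using cyc[OF that] T(2) by (rule cycle_in_insert_mem)
  have "\<exists>s :: 'v set \<Rightarrow> 'r. (\<forall>e'. s e' \<in> {1, - 1}) \<and> s e = 1 \<and>
      (\<forall>\<phi>. (\<Sum>e'\<in>?C e. s e' * (\<phi> (src e') - \<phi> (tgt e'))) = 0)" if e: "e \<in> E - T" for e
  proof (rule cycle_signs_normalised[OF cyc[OF e]])
    show "orientation (?C e) src tgt"
      using sub[OF e] e T(1) assms(4) by (auto simp: orientation_def)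
  qed
  then have "\<forall>e. \<exists>s :: 'v set \<Rightarrow> 'r. e \<in> E - T \<longrightarrow> (\<forall>e'. s e' \<in> {1, - 1}) \<and> s e = 1 \<and>
      (\<forall>\<phi>. (\<Sum>e'\<in>?C e. s e' * (\<phi> (src e') - \<phi> (tgt e'))) = 0)"
    by meson
  from choice[OF this] obtain \<sigma> :: "'v set \<Rightarrow> 'v set \<Rightarrow> 'r" where
    \<sigma>: "\<And>e e'. e \<in> E - T \<Longrightarrow> \<sigma> e e' \<in> {1, - 1}" "\<And>e. e \<in> E - T \<Longrightarrow> \<sigma> e e = 1"
      "\<And>e \<phi>. e \<in> E - T \<Longrightarrow> (\<Sum>e'\<in>?C e. \<sigma> e e' * (\<phi> (src e') - \<phi> (tgt e'))) = 0"
    by blast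
  \<comment> \<open>\<open>N\<close> adds to the row of a non-tree edge the signed rows of the tree
    edges in its cycle.\<close>
  define N where "N a b = (if a \<in> E - T \<and> b \<in> T \<and> b \<in> ?C a then \<sigma> a b else 0)" for a b
  \<comment> \<open>Listing the rows by \<open>ts @ cs\<close> and the columns by \<open>es\<close>
    also moves the tree rows to the top. \<open>P\<close> does not depend on
    \<open>q\<close>.\<close>
  define P where "P = list_mat (ts @ cs) es (\<lambda>a b. of_bool (a = b) + N a b)"
  have enum: "distinct vs" "set vs = V" "distinct es" "set es = E" "distinct (ts @ cs)"
    "set (ts @ cs) = E" "set ts = T" "set cs = E - T"
    using assms(6-9) T(1) by (auto simp: enumerates_def)
  have finE: "finite E" using enum(4) by auto
  have n: "length vs = n" using enum(1,2) assms(2) distinct_card by fastforce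
  have len: "length (ts @ cs) = length es" using enum(3-6) by (metis distinct_card)
  have NN: "N a b * N b c = 0" for a b c by (simp add: N_def)
  have "invertible_mat P"
    unfolding P_def by (rule invertible_list_mat_square_zero) (use enum NN in auto)
  moreover have P_carrier: "P \<in> carrier_mat (length es) (length es)"
    unfolding P_def by (metis len list_mat_carrier)
  moreover have "extended_gkm_matrix src tgt vs ts q @\<^sub>r
      last_column_rows n cs (\<lambda>e. \<Sum>e'\<in>?C e. \<sigma> e e' * q e') =
      P * extended_gkm_matrix src tgt vs es q" for q
  proof -
    \<comment> \<open>\<open>r\<close> gives the entries of the original matrix and
      \<open>r'\<close> those of the target.\<close>
    define r where "r e j = (if j < n
        then if vs ! j = src e then 1 else if vs ! j = tgt e then - 1 else 0 else q e)" for e j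
    define r' where "r' e j = (if e \<in> T then r e j
        else if j = n then \<Sum>e'\<in>?C e. \<sigma> e e' * q e' else 0)" for e j
    have row: "(\<Sum>b\<in>E. (of_bool (a = b) + N a b) * r b j) = r' a j"
      if a: "a \<in> E" and j: "j < n + 1" for a j
    proof (cases "a \<in> T")
      case True
      then have "(\<Sum>b\<in>E. (of_bool (a = b) + N a b) * r b j) = (\<Sum>b\<in>E. if a = b then r b j else 0)"
        by (intro sum.cong) (auto simp: N_def)
      with True a finE show ?thesis by (simp add: r'_def)
    next
      case False
      with a have aET: "a \<in> E - T" by simp
      \<comment> \<open>The identity part supplies the term \<open>b = a\<close>, as
        \<open>\<sigma> a a = 1\<close>; \<open>N\<close> supplies the tree edges of the
        cycle.\<close>
      have "(\<Sum>b\<in>E. (of_bool (a = b) + N a b) * r b j) = (\<Sum>b\<in>?C a. \<sigma> a b * r b j)"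
        using sub[OF aET] mem[OF aET] \<sigma>(2)[OF aET] T(1) finE aET
        by (intro sum.mono_neutral_cong_right) (auto simp: N_def)
      also have "\<dots> = r' a j"
      proof (cases "j = n")
        case True
        with False show ?thesis by (simp add: r_def r'_def)
      next
        case neq: False
        with j have jn: "j < n" by simp
        \<comment> \<open>Distinct ends make the nested conditional in \<open>r\<close> a difference
          of two indicators; at a loop it would give 1 instead of 0.\<close>
        have "src b \<noteq> tgt b" if "b \<in> E" for b
          using that assms(1,4) unfolding simple_graph_def orientation_def
          by (metis card_2_iff doubleton_eq_iff)
        then have "(\<Sum>b\<in>?C a. \<sigma> a b * r b j) =
            (\<Sum>b\<in>?C a. \<sigma> a b * (of_bool (vs ! j = src b) - of_bool (vs ! j = tgt b)))"
          using jn sub[OF aET] T(1) aET by (intro sum.cong) (auto simp: r_def)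
        \<comment> \<open>Here \<open>\<phi>\<close> is the indicator of the vertex of column
          \<open>j\<close>.\<close>
        also have "\<dots> = 0" using \<sigma>(3)[OF aET, of "\<lambda>x. of_bool (vs ! j = x)"] .
        finally show ?thesis using neq False by (simp add: r'_def)
      qed
      finally show ?thesis .
    qed
    have "extended_gkm_matrix src tgt vs ts q = list_mat ts [0..<n + 1] r'"
      unfolding extended_gkm_matrix_eq_list_mat n
      by (rule list_mat_cong) (use enum in \<open>auto simp: r_def r'_def\<close>)
    moreover have "last_column_rows n cs (\<lambda>e. \<Sum>e'\<in>?C e. \<sigma> e e' * q e') =
        list_mat cs [0..<n + 1] r'"
      unfolding last_column_rows_eq_list_mat
      by (rule list_mat_cong) (use enum in \<open>auto simp: r'_def\<close>)
    moreover have "P * extended_gkm_matrix src tgt vs es q = list_mat (ts @ cs) [0..<n + 1] r'"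
      unfolding extended_gkm_matrix_eq_list_mat n P_def r_def[symmetric] list_mat_mult[OF enum(3)]
      by (rule list_mat_cong, unfold enum(4,6), rule row) auto
    ultimately show ?thesis by (simp only: list_mat_append_rows)
  qed
  ultimately have "row_equivalent (extended_gkm_matrix src tgt vs es q)
      (extended_gkm_matrix src tgt vs ts q @\<^sub>r
        last_column_rows n cs (\<lambda>e. \<Sum>e'\<in>?C e. \<sigma> e e' * q e'))" for q
    unfolding row_equivalent_def by (intro bexI[of _ P]) (auto simp: extended_gkm_matrix_def)
  with \<sigma>(1) show ?thesis by (intro exI[of _ \<sigma>]) blast
qed

end
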